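(* Let $h_d(x) = 1 - e^{-x}\sum_{i=0}^{d-1} \frac{x^i}{i!}$ for integers $d\ge 1$ and real $x\ge 0$. Let $c^*$ be the unique positive real solution of $2h_2(x) = 3h_3(x)$ (numerically $c^*\approx 2.655$), and let $\rho = 2h_2(c^* )/c^* \approx 0.5598$. Then: (i) for every integer $k \ge 1$ and every probability distribution $F$ on $[0,\infty)$, \[ BRev(F^k) \ge \rho\, k\, Rev(F) = \rho\, SRev(F^k); \] (ii) the bound is tight: for every $\epsilon > 0$ there exist an integer $k\ge 1$ and a probability distribution $F$ on $[0,\infty)$ such that \[ BRev(F^k) < (\rho + \epsilon)\, SRev(F^k). \]
   Context: A single seller sells $k$ items to a single additive buyer whose values $X_1,\dots,X_k$ for the items are i.i.d. with distribution $F$ (known to the seller); $F^k$ denotes the product distribution. $Rev(F)$ is the optimal revenue from selling one item to a buyer with value $X\sim F$, which (by Myerson) equals $\sup_{p\ge 0} p\cdot \mathbb{P}(X\ge p)$. $SRev(F^k)$ is the maximal revenue obtainable by selling each item separately, which equals $k\,Rev(F)$. $BRev(F^k)$ is the maximal revenue obtainable by selling all $k$ items as a single bundle at a posted price, i.e. $\sup_{p\ge 0} p\cdot \mathbb{P}(X_1+\dots+X_k \ge p)$. *)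

theory Defs
  imports "HOL-Probability.Probability"
begin

definition h :: "nat \<Rightarrow> real \<Rightarrow> real" where
  "h d x = 1 - exp (- x) * (\<Sum>i<d. x ^ i / fact i)"

definition cstar :: real where
  "cstar = (THE x. x > 0 \<and> 2 * h 2 x = 3 * h 3 x)"

definition rho :: real where
  "rho = 2 * h 2 cstar / cstar"

definition nonneg_dist :: "real measure \<Rightarrow> bool" where
  "nonneg_dist F \<longleftrightarrow> prob_space F \<and> sets F = sets borel \<and> measure F {0..} = 1"

text \<open>Optimal single-item revenue (Myerson): sup over prices p >= 0 of p * P(X >= p).
  Valued in ennreal since the supremum may be infinite.\<close>
definition Rev :: "real measure \<Rightarrow> ennreal" where
  "Rev F = (SUP p\<in>{0..}. ennreal (p * measure F {p..}))"

definition SRev :: "real measure \<Rightarrow> nat \<Rightarrow> ennreal" where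
  "SRev F k = of_nat k * Rev F"

definition BRev :: "real measure \<Rightarrow> nat \<Rightarrow> ennreal" where
  "BRev F k = (SUP p\<in>{0..}. ennreal (p * measure (PiM {..<k} (\<lambda>_. F))
      {x \<in> space (PiM {..<k} (\<lambda>_. F)). p \<le> (\<Sum>i<k. x i)}))"

end

theory Submission
  imports Defs
begin

text \<open>
  If \<open>q\<close> is the probability of a sale at price \<open>p\<close>, the sum of the values dominates \<open>p\<close> times a
  binomial \<open>(k, q)\<close> variable, and Bernoulli distributions attain this. So the bound says that
  the maximum over \<open>j\<close> of \<open>j P(Bin(k, q) \<ge> j)\<close> is at least \<open>\<rho> k q\<close>.

  Put \<open>x = k q\<close>. Moving mass continuously from the Bernoulli variables to a Poisson variable, at
  constant mean \<open>x\<close>, increases \<open>P(< j)\<close> as long as \<open>j - 1 \<le> x - q\<close>; hence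
  \<open>P(Bin(k, q) \<ge> j) \<ge> h\<^sub>j(x)\<close> in that range. As \<open>h\<^sub>j\<close> is concave on \<open>[j - 1, \<infinity>)\<close>, the
  inequality \<open>j h\<^sub>j(x) \<ge> \<rho> x\<close> propagates from the endpoints of an interval to its interior. Finitely many
  intervals cover \<open>[0, 18]\<close>, the two for \<open>j = 2, 3\<close> meeting at \<open>c\<^sup>*\<close> with equality, and
  a geometric bound of the lower tail handles \<open>x \<ge> 18\<close>. For \<open>k \<le> 4\<close>, where the range of \<open>j\<close> is
  too small for this, polynomial inequalities in \<open>q\<close> suffice.

  For tightness take \<open>q = c\<^sup>* / k\<close>: the same deformation shows that the binomial tails are within
  \<open>c\<^sup>*\<^sup>2 / k\<close> of the Poisson tails, and \<open>j h\<^sub>j(c\<^sup>*) \<le> \<rho> c\<^sup>*\<close> for all \<open>j\<close>.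
\<close>

section \<open>Poisson tails\<close>

text \<open>The Lagrange remainder is a positive multiple of \<open>x ^ n\<close>. The even case
  serves the bound of \<open>exp (-2.63)\<close>.\<close>

lemma exp_partial_sum_le:
  fixes x :: real
  assumes "0 \<le> x \<or> even n"
  shows "(\<Sum>i<n. x ^ i / fact i) \<le> exp x"
proof -
  obtain t where "exp x = (\<Sum>m<n. x ^ m / fact m) + exp t / fact n * x ^ n"
    using Maclaurin_exp_le by blast
  moreover have "0 \<le> x ^ n"
    using assms by (auto simp: zero_le_even_power)
  ultimately show ?thesis by simp
qed

lemma h_Suc: "h (Suc d) x = h d x - exp (- x) * x ^ d / fact d"
  by (simp add: h_def algebra_simps)

lemma h_0 [simp]: "h 0 x = 1"
  by (simp add: h_def)

lemma h_at_0 [simp]: "h (Suc d) 0 = 0"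
  by (induction d) (simp_all add: h_Suc)

lemma h_nonneg: "0 \<le> x \<Longrightarrow> 0 \<le> h d x"
  using mult_left_mono[OF exp_partial_sum_le[of x d], of "exp (- x)"]
  by (simp add: h_def flip: exp_add)

lemma h_le_1: "0 \<le> x \<Longrightarrow> h d x \<le> 1"
  by (simp add: h_def sum_nonneg)

text \<open>The derivatives of the Poisson masses telescope. What remains is the Gamma density with
  shape \<open>Suc d\<close>.\<close>

lemma h_Suc_deriv: "(h (Suc d) has_real_derivative exp (- x) * x ^ d / fact d) (at x)"
proof (induction d)
  case 0
  have "h (Suc 0) = (\<lambda>x. 1 - exp (- x))" by (auto simp: h_def)
  then show ?case by (auto intro!: derivative_eq_intros)
next
  case (Suc d)
  have eq: "h (Suc (Suc d)) = (\<lambda>x. h (Suc d) x - exp (- x) * x ^ Suc d / fact (Suc d))"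
    by (rule ext) (rule h_Suc)
  have *: "((\<lambda>x. x ^ Suc d / fact (Suc d)) has_real_derivative x ^ d / fact d) (at x)"
  proof -
    have "((\<lambda>x. x ^ Suc d / fact (Suc d)) has_real_derivative real (Suc d) * x ^ d / fact (Suc d)) (at x)"
      by (rule DERIV_cdivide) (use DERIV_pow[of "Suc d" x] in simp)
    then show ?thesis by (simp del: of_nat_Suc)
  qed
  have "((\<lambda>x. exp (- x) * (x ^ Suc d / fact (Suc d))) has_real_derivative
      (- exp (- x)) * (x ^ Suc d / fact (Suc d)) + (x ^ d / fact d) * exp (- x)) (at x)"
    by (rule DERIV_mult[OF _ *]) (auto intro!: derivative_eq_intros)
  from DERIV_diff[OF Suc this] show ?case
    unfolding eq by (simp add: algebra_simps del: fact_Suc power_Suc)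
qed

text \<open>The Gamma density decreases from its mode \<open>d\<close> onwards.\<close>

lemma concave_on_h: "concave_on {real d..} (h (Suc d))"
proof (rule f''_le0_imp_concave)
  fix x :: real assume x: "x \<in> {real d..}"
  show "(h (Suc d) has_real_derivative exp (- x) * x ^ d / fact d) (at x)"
    by (rule h_Suc_deriv)
  show "((\<lambda>x. exp (- x) * x ^ d / fact d) has_real_derivative
     exp (- x) * (real d * x ^ (d - 1) - x ^ d) / fact d) (at x)"
    by (auto intro!: derivative_eq_intros simp: field_simps)
  have "real d * x ^ (d - 1) \<le> x ^ d"
    using x by (cases d) (auto intro!: mult_right_mono)
  then show "exp (- x) * (real d * x ^ (d - 1) - x ^ d) / fact d \<le> 0"
    by (intro divide_nonpos_pos mult_nonneg_nonpos) auto
qed simp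

text \<open>A concave function lies above its chord, so an inequality on a whole interval reduces to
  its two endpoints.\<close>

lemma h_ge_linear_between:
  assumes "real d \<le> a" "a \<le> x" "x \<le> b"
    and "r * a \<le> h (Suc d) a" "r * b \<le> h (Suc d) b"
  shows "r * x \<le> h (Suc d) x"
proof (cases "a = b")
  case True
  then show ?thesis using assms by simp
next
  case False
  define t where "t = (x - a) / (b - a)"
  have t: "0 \<le> t" "t \<le> 1" and xt: "x = (1 - t) * a + t * b"
    using assms False by (auto simp: t_def divide_simps) (simp add: algebra_simps)
  have "r * x = (1 - t) * (r * a) + t * (r * b)"
    by (simp add: xt algebra_simps)
  also have "\<dots> \<le> (1 - t) * h (Suc d) a + t * h (Suc d) b"
    using assms t by (intro add_mono mult_left_mono) auto
  also have "\<dots> \<le> h (Suc d) x"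
    using concave_onD[OF concave_on_h[of d] t, of a b] assms by (simp add: xt)
  finally show ?thesis .
qed

text \<open>The fourth hypothesis forces \<open>s \<le> 1\<close>, since the partial sum is
  nonnegative. Hence \<open>(1 - s) * E\<close> may be raised to
  \<open>(1 - s) * exp x\<close>.\<close>

lemma h_ge_from_exp_lower_bound:
  assumes "0 < E" "E \<le> exp x" "0 \<le> x" "(\<Sum>i<d. x ^ i / fact i) \<le> (1 - s) * E"
  shows "s \<le> h d x"
proof -
  have "0 \<le> (1 - s) * E" using assms(3,4) by (meson order_trans sum_nonneg divide_nonneg_pos fact_gt_zero zero_le_power)
  then have "0 \<le> 1 - s" using assms(1) by (simp add: zero_le_mult_iff)
  then have "(\<Sum>i<d. x ^ i / fact i) \<le> (1 - s) * exp x"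
    using assms(2,4) by (meson mult_left_mono order_trans)
  then have "exp (- x) * (\<Sum>i<d. x ^ i / fact i) \<le> exp (- x) * ((1 - s) * exp x)"
    by (intro mult_left_mono) auto
  also have "\<dots> = 1 - s" by (simp add: exp_minus)
  finally show ?thesis by (simp add: h_def)
qed

text \<open>The value 0.564 is a rational upper bound of \<open>rho\<close>. Each point where the
  bundle size \<open>j\<close> changes is checked for both neighbouring \<open>j\<close>, except the
  exact one at \<open>cstar\<close>. Truncating the series of \<open>exp x\<close> after
  \<open>n\<close> terms makes each check rational arithmetic.\<close>

lemma h_endpoint_bounds:
  "0.564 / 1 * 1.25 \<le> h 1 1.25"
  "0.564 / 2 * 1.25 \<le> h 2 1.25"
  "0.564 / 3 * 4 \<le> h 3 4"
  "0.564 / 4 * 4 \<le> h 4 4"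
  "0.564 / 4 * 6 \<le> h 4 6"
  "0.564 / 5 * 6 \<le> h 5 6"
  "0.564 / 5 * 7.5 \<le> h 5 7.5"
  "0.564 / 7 * 7.5 \<le> h 7 7.5"
  "0.564 / 7 * 11.5 \<le> h 7 11.5"
  "0.564 / 11 * 11.5 \<le> h 11 11.5"
  "0.564 / 11 * 18 \<le> h 11 18"
proof -
  have L: "s \<le> h d x" if "0 < x" "0 < n" "(\<Sum>i<d. x ^ i / fact i) \<le> (1 - s) * (\<Sum>i<n. x ^ i / fact i)"
    for s d n and x :: real
    using that exp_partial_sum_le[of x n]
    by (intro h_ge_from_exp_lower_bound[of "\<Sum>i<n. x ^ i / fact i"] sum_pos) (auto simp: lessThan_empty_iff)
  note numeric = lessThan_nat_numeral lessThan_Suc fact_numeral power_divide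
  show "0.564 / 1 * 1.25 \<le> h 1 1.25"
    by (rule L[where n = 5]) (simp_all add: numeric)
  show "0.564 / 2 * 1.25 \<le> h 2 1.25"
    by (rule L[where n = 6]) (simp_all add: numeric)
  show "0.564 / 3 * 4 \<le> h 3 4"
    by (rule L[where n = 9]) (simp_all add: numeric)
  show "0.564 / 4 * 4 \<le> h 4 4"
    by (rule L[where n = 11]) (simp_all add: numeric)
  show "0.564 / 4 * 6 \<le> h 4 6"
    by (rule L[where n = 13]) (simp_all add: numeric)
  show "0.564 / 5 * 6 \<le> h 5 6"
    by (rule L[where n = 10]) (simp_all add: numeric)
  show "0.564 / 5 * 7.5 \<le> h 5 7.5"
    by (rule L[where n = 11]) (simp_all add: numeric)
  show "0.564 / 7 * 7.5 \<le> h 7 7.5"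
    by (rule L[where n = 13]) (simp_all add: numeric)
  show "0.564 / 7 * 11.5 \<le> h 7 11.5"
    by (rule L[where n = 16]) (simp_all add: numeric)
  show "0.564 / 11 * 11.5 \<le> h 11 11.5"
    by (rule L[where n = 20]) (simp_all add: numeric)
  show "0.564 / 11 * 18 \<le> h 11 18"
    by (rule L[where n = 18]) (simp_all add: numeric)
qed

section \<open>Interpolation between binomial and Poisson\<close>

text \<open>\<open>pb_below k q l j\<close> is the probability that the sum of independent binomial \<open>(k, q)\<close> and
  Poisson \<open>(l)\<close> variables is less than \<open>j\<close>, so \<open>l = 0\<close> is the binomial and \<open>k = 0\<close> the Poisson
  case. The truncation \<open>0 - 1 = 0\<close> in the recursion is harmless because the value at \<open>j = 0\<close> is \<open>0\<close>.\<close>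
primrec pb_below :: "nat \<Rightarrow> real \<Rightarrow> real \<Rightarrow> nat \<Rightarrow> real" where
  "pb_below 0 q l j = 1 - h j l"
| "pb_below (Suc k) q l j = (1 - q) * pb_below k q l j + q * pb_below k q l (j - 1)"

definition pb_mass :: "nat \<Rightarrow> real \<Rightarrow> real \<Rightarrow> nat \<Rightarrow> real" where
  "pb_mass k q l m = pb_below k q l (Suc m) - pb_below k q l m"

lemma pb_below_0 [simp]: "pb_below k q l 0 = 0"
  by (induction k) auto

lemma pb_below_zero_prob: "pb_below k 0 l j = 1 - h j l"
  by (induction k) auto

lemma pb_mass_base: "pb_mass 0 q l m = exp (- l) * l ^ m / fact m"
  by (simp add: pb_mass_def h_Suc)

lemma pb_mass_Suc_0: "pb_mass (Suc k) q l 0 = (1 - q) * pb_mass k q l 0"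
  by (simp add: pb_mass_def)

lemma pb_mass_Suc_Suc:
  "pb_mass (Suc k) q l (Suc m) = (1 - q) * pb_mass k q l (Suc m) + q * pb_mass k q l m"
  by (simp add: pb_mass_def algebra_simps)

lemma pb_below_bounds:
  assumes "0 \<le> q" "q \<le> 1" "0 \<le> l"
  shows "0 \<le> pb_below k q l j \<and> pb_below k q l j \<le> 1"
proof (induction k arbitrary: j)
  case 0
  then show ?case using assms h_nonneg h_le_1 by auto
next
  case (Suc k)
  have "(1 - q) * pb_below k q l j + q * pb_below k q l (j - 1) \<le> (1 - q) * 1 + q * 1"
    using Suc assms by (intro add_mono mult_left_mono) auto
  with Suc assms show ?case by auto
qed

lemma pb_mass_nonneg:
  assumes "0 \<le> q" "q \<le> 1" "0 \<le> l"
  shows "0 \<le> pb_mass k q l m"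
proof (induction k arbitrary: m)
  case 0
  then show ?case using assms by (simp add: pb_mass_base)
next
  case (Suc k)
  then show ?case using assms by (cases m) (auto simp: pb_mass_Suc_0 pb_mass_Suc_Suc)
qed

lemma pb_mass_le_1:
  assumes "0 \<le> q" "q \<le> 1" "0 \<le> l"
  shows "pb_mass k q l m \<le> 1"
  using pb_below_bounds[OF assms, of k "Suc m"] pb_below_bounds[OF assms, of k m]
  by (simp add: pb_mass_def)

text \<open>Size-bias identity: singling out one success among the \<open>k\<close> trials leaves
  \<open>k - 1\<close> trials, while singling out a Poisson point leaves the distribution unchanged.
  For \<open>k = 0\<close> the truncated \<open>k - 1\<close> is multiplied by zero.\<close>

lemma pb_mass_size_bias:
  "real (Suc m) * pb_mass k q l (Suc m) = l * pb_mass k q l m + real k * q * pb_mass (k - 1) q l m"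
proof (induction k arbitrary: m)
  case 0
  have "real (Suc m) * (exp (- l) * l ^ Suc m / fact (Suc m)) = l * (exp (- l) * l ^ m / fact m)"
    by (simp add: field_simps del: of_nat_Suc)
  then show ?case by (simp add: pb_mass_base del: of_nat_Suc)
next
  case (Suc k)
  show ?case
  proof (cases m)
    case 0
    have a: "pb_mass k q l (Suc 0) = l * pb_mass k q l 0 + real k * q * pb_mass (k - 1) q l 0"
      using Suc[of 0] by simp
    have b: "real k * pb_mass k q l 0 = real k * ((1 - q) * pb_mass (k - 1) q l 0)"
      by (cases k) (auto simp: pb_mass_Suc_0)
    have "pb_mass (Suc k) q l (Suc 0) = l * ((1 - q) * pb_mass k q l 0)
        + q * (real k * ((1 - q) * pb_mass (k - 1) q l 0)) + q * pb_mass k q l 0"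
      by (simp add: pb_mass_Suc_Suc a algebra_simps)
    then show ?thesis unfolding b[symmetric] by (simp add: 0 pb_mass_Suc_0 algebra_simps)
  next
    case m: (Suc n)
    have a: "real (Suc m) * pb_mass k q l (Suc m) = l * pb_mass k q l m + real k * q * pb_mass (k - 1) q l m"
      by (rule Suc)
    have a': "real m * pb_mass k q l m = l * pb_mass k q l n + real k * q * pb_mass (k - 1) q l n"
      using Suc[of n] m by simp
    have b: "real k * pb_mass k q l m = real k * ((1 - q) * pb_mass (k - 1) q l m + q * pb_mass (k - 1) q l n)"
      by (cases k) (auto simp: m pb_mass_Suc_Suc)
    have "real (Suc m) * pb_mass (Suc k) q l (Suc m) =
       (1 - q) * (real (Suc m) * pb_mass k q l (Suc m)) + q * (real m * pb_mass k q l m) + q * pb_mass k q l m"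
      by (simp add: pb_mass_Suc_Suc algebra_simps)
    also have "\<dots> = l * ((1 - q) * pb_mass k q l m + q * pb_mass k q l n)
       + q * (real k * ((1 - q) * pb_mass (k - 1) q l m + q * pb_mass (k - 1) q l n)) + q * pb_mass k q l m"
      unfolding a a' by (simp add: algebra_simps)
    also have "\<dots> = l * pb_mass (Suc k) q l m + real (Suc k) * q * pb_mass k q l m"
      unfolding b[symmetric] by (simp add: m pb_mass_Suc_Suc algebra_simps)
    finally show ?thesis by simp
  qed
qed

lemma pb_mass_mono_below_mean:
  assumes "0 \<le> q" "q \<le> 1" "0 \<le> l" "real (Suc m) \<le> l + real k * q"
  shows "pb_mass k q l m \<le> pb_mass k q l (Suc m)"
  using assms(4)
proof (induction k arbitrary: m)
  case 0
  have "real (Suc m) * pb_mass 0 q l m \<le> l * pb_mass 0 q l m"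
    using 0 pb_mass_nonneg[OF assms(1-3)] by (intro mult_right_mono) auto
  then have "real (Suc m) * pb_mass 0 q l m \<le> real (Suc m) * pb_mass 0 q l (Suc m)"
    unfolding pb_mass_size_bias by simp
  then show ?case by (simp del: of_nat_Suc)
next
  case (Suc k)
  \<comment> \<open>The mass at \<open>m\<close> with one more trial mixes the old masses at
    \<open>m\<close> and \<open>m - 1\<close>. The latter is no larger, by induction: as
    \<open>q \<le> 1\<close>, dropping a trial lowers the mean by at most 1.\<close>
  have less: "pb_mass (Suc k) q l m \<le> pb_mass k q l m"
  proof (cases m)
    case 0
    then show ?thesis using assms pb_mass_nonneg[OF assms(1-3), of k 0]
      by (simp add: pb_mass_Suc_0 mult_left_le_one_le)
  next
    case m: (Suc n)
    have "q * pb_mass k q l n \<le> q * pb_mass k q l (Suc n)"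
      using Suc m assms by (intro mult_left_mono Suc.IH) (auto simp: algebra_simps)
    then show ?thesis by (simp add: m pb_mass_Suc_Suc algebra_simps)
  qed
  have "real (Suc m) * pb_mass (Suc k) q l m \<le> (l + real (Suc k) * q) * pb_mass (Suc k) q l m"
    using Suc.prems pb_mass_nonneg[OF assms(1-3)] by (intro mult_right_mono) auto
  also have "\<dots> = l * pb_mass (Suc k) q l m + real (Suc k) * q * pb_mass (Suc k) q l m"
    by (simp add: algebra_simps)
  also have "\<dots> \<le> l * pb_mass (Suc k) q l m + real (Suc k) * q * pb_mass k q l m"
    using less assms by (intro add_left_mono mult_left_mono) auto
  also have "\<dots> = real (Suc m) * pb_mass (Suc k) q l (Suc m)"
    unfolding pb_mass_size_bias by simp
  finally show ?case by (simp del: of_nat_Suc)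
qed

text \<open>Only jumps from \<open>m\<close> to \<open>Suc m\<close> change the probability. Each
  trial contributes the mass at \<open>m\<close> of the other \<open>k - 1\<close> trials, and the
  Poisson part that of the whole sum. The speed \<open>s\<close> is separate from \<open>k\<close>
  because the induction changes \<open>k\<close> alone.\<close>

lemma pb_below_path_deriv:
  "((\<lambda>t. pb_below k (q - t) (s * t) (Suc m)) has_real_derivative
     real k * pb_mass (k - 1) (q - t) (s * t) m - s * pb_mass k (q - t) (s * t) m) (at t)"
proof (induction k arbitrary: m)
  case 0
  have "((\<lambda>t. h (Suc m) (s * t)) has_real_derivative (exp (- (s * t)) * (s * t) ^ m / fact m) * s) (at t)"
    by (rule DERIV_chain2[OF h_Suc_deriv]) (auto intro!: derivative_eq_intros)
  then show ?case
    by (auto intro!: derivative_eq_intros simp: pb_mass_base mult_ac)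
next
  case (Suc k)
  let ?p = "\<lambda>k. pb_mass k (q - t) (s * t)"
  show ?case
  proof (cases m)
    case 0
    have b: "real k * ?p k 0 = real k * ((1 - (q - t)) * ?p (k - 1) 0)"
      by (cases k) (auto simp: pb_mass_Suc_0)
    have "((\<lambda>t. (1 - (q - t)) * pb_below k (q - t) (s * t) (Suc 0)) has_real_derivative
        pb_below k (q - t) (s * t) (Suc 0) + (1 - (q - t)) * (real k * ?p (k - 1) 0 - s * ?p k 0)) (at t)"
      by (auto intro!: derivative_eq_intros Suc)
    also have "pb_below k (q - t) (s * t) (Suc 0) = ?p k 0" by (simp add: pb_mass_def)
    also have "?p k 0 + (1 - (q - t)) * (real k * ?p (k - 1) 0 - s * ?p k 0) =
       ?p k 0 + real k * ((1 - (q - t)) * ?p (k - 1) 0) - s * ((1 - (q - t)) * ?p k 0)"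
      by (simp add: algebra_simps)
    also have "\<dots> = real (Suc k) * ?p k 0 - s * ?p (Suc k) 0"
      unfolding b[symmetric] pb_mass_Suc_0 by (simp add: algebra_simps)
    finally show ?thesis by (simp add: 0)
  next
    case m: (Suc n)
    have b: "real k * ?p k m = real k * ((1 - (q - t)) * ?p (k - 1) m + (q - t) * ?p (k - 1) n)"
      by (cases k) (auto simp: m pb_mass_Suc_Suc)
    have "((\<lambda>t. (1 - (q - t)) * pb_below k (q - t) (s * t) (Suc m) + (q - t) * pb_below k (q - t) (s * t) m) has_real_derivative
        pb_below k (q - t) (s * t) (Suc m) + (1 - (q - t)) * (real k * ?p (k - 1) m - s * ?p k m)
        + (- pb_below k (q - t) (s * t) m + (q - t) * (real k * ?p (k - 1) n - s * ?p k n))) (at t)"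
      unfolding m by (auto intro!: derivative_eq_intros Suc)
    also have "pb_below k (q - t) (s * t) (Suc m) + (1 - (q - t)) * (real k * ?p (k - 1) m - s * ?p k m)
        + (- pb_below k (q - t) (s * t) m + (q - t) * (real k * ?p (k - 1) n - s * ?p k n))
       = ?p k m + real k * ((1 - (q - t)) * ?p (k - 1) m + (q - t) * ?p (k - 1) n) - s * ((1 - (q - t)) * ?p k m + (q - t) * ?p k n)"
      by (simp add: pb_mass_def algebra_simps)
    also have "\<dots> = real (Suc k) * ?p k m - s * ?p (Suc k) m"
      unfolding b[symmetric] by (simp add: m pb_mass_Suc_Suc algebra_simps)
    finally show ?thesis by simp
  qed
qed

text \<open>Trading Bernoulli mass for Poisson mass at constant mean: at \<open>t = 0\<close> the variable is binomial,
  at \<open>t = q\<close> it is Poisson with the same mean. The derivative is a multiple of a difference of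
  consecutive masses, nonnegative below the mean and at most \<open>1\<close> everywhere.\<close>
lemma pb_below_poissonize_deriv:
  "((\<lambda>t. pb_below (Suc k) (q - t) (real (Suc k) * t) (Suc m)) has_real_derivative
     real (Suc k) * (q - t) * (pb_mass k (q - t) (real (Suc k) * t) m
       - (if m = 0 then 0 else pb_mass k (q - t) (real (Suc k) * t) (m - 1)))) (at t)"
  using pb_below_path_deriv[of "Suc k" q "real (Suc k)" m t]
  by (cases m) (auto simp: pb_mass_Suc_0 pb_mass_Suc_Suc algebra_simps)

text \<open>The masses in the derivative belong to \<open>k\<close> trials, with mean
  \<open>k * q + t\<close> along the path. This stays at least \<open>m\<close>, so
  \<open>pb_mass_mono_below_mean\<close> applies throughout.\<close>

lemma binomial_below_le_poisson:
  assumes "0 \<le> q" "q \<le> 1" "real m \<le> real k * q"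
  shows "pb_below (Suc k) q 0 (Suc m) \<le> 1 - h (Suc m) (real (Suc k) * q)"
proof -
  let ?f = "\<lambda>t. pb_below (Suc k) (q - t) (real (Suc k) * t) (Suc m)"
  have "?f 0 \<le> ?f q"
  proof (rule DERIV_nonneg_imp_nondecreasing[OF assms(1)])
    fix t assume t: "0 \<le> t" "t \<le> q"
    have "0 \<le> pb_mass k (q - t) (real (Suc k) * t) m
       - (if m = 0 then 0 else pb_mass k (q - t) (real (Suc k) * t) (m - 1))"
    proof (cases m)
      case 0
      then show ?thesis using t assms pb_mass_nonneg by simp
    next
      case (Suc n)
      then show ?thesis using t assms pb_mass_mono_below_mean[of "q - t" "real (Suc k) * t" n k]
        by (simp add: algebra_simps)
    qed
    then have "0 \<le> real (Suc k) * (q - t) * (pb_mass k (q - t) (real (Suc k) * t) m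
       - (if m = 0 then 0 else pb_mass k (q - t) (real (Suc k) * t) (m - 1)))"
      using t by (intro mult_nonneg_nonneg) auto
    with pb_below_poissonize_deriv show "\<exists>y. (?f has_real_derivative y) (at t) \<and> 0 \<le> y"
      by blast
  qed
  then show ?thesis by (simp add: pb_below_zero_prob del: pb_below.simps of_nat_Suc)
qed

text \<open>The derivative along the path is at most \<open>Suc k * q\<close>, and the path has
  length \<open>q\<close>. Subtracting the probability from a line of that slope gives a
  nondecreasing function.\<close>

lemma le_Cam_binomial:
  assumes "0 \<le> q" "q \<le> 1"
  shows "1 - pb_below (Suc k) q 0 (Suc m) \<le> h (Suc m) (real (Suc k) * q) + real (Suc k) * q\<^sup>2"
proof -
  let ?d = "\<lambda>t. pb_mass k (q - t) (real (Suc k) * t) m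
     - (if m = 0 then 0 else pb_mass k (q - t) (real (Suc k) * t) (m - 1))"
  let ?f = "\<lambda>t. real (Suc k) * q * t - pb_below (Suc k) (q - t) (real (Suc k) * t) (Suc m)"
  have deriv: "(?f has_real_derivative real (Suc k) * q - real (Suc k) * (q - t) * ?d t) (at t)" for t
    by (intro DERIV_diff pb_below_poissonize_deriv DERIV_cmult_Id)
  have nonneg: "0 \<le> real (Suc k) * q - real (Suc k) * (q - t) * ?d t" if t: "0 \<le> t" "t \<le> q" for t
  proof -
    have range: "0 \<le> q - t" "q - t \<le> 1" "0 \<le> real (Suc k) * t"
      using t assms by simp_all
    have "?d t \<le> 1"
      using pb_mass_le_1[OF range, of k m] pb_mass_nonneg[OF range, of k "m - 1"]
      by (cases "m = 0") simp_all
    then have "real (Suc k) * (q - t) * ?d t \<le> real (Suc k) * (q - t) * 1"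
      using range(1) by (intro mult_left_mono) simp_all
    also have "\<dots> \<le> real (Suc k) * q"
      using t(1) by (simp add: mult_left_mono)
    finally show ?thesis by simp
  qed
  have "?f 0 \<le> ?f q"
    using assms(1) by (rule DERIV_nonneg_imp_nondecreasing) (rule exI conjI deriv nonneg | assumption)+
  then show ?thesis by (simp add: pb_below_zero_prob power2_eq_square mult.assoc del: pb_below.simps of_nat_Suc)
qed

text \<open>Union bound over the \<open>j\<close>-subsets of the trials. It controls all large
  \<open>j\<close> at once, where a Le Cam error multiplied by \<open>j\<close> would be too
  weak.\<close>

lemma binomial_tail_le:
  assumes "0 \<le> q" "q \<le> 1"
  shows "1 - pb_below k q 0 j \<le> (real k * q) ^ j / fact j"
proof -
  have "1 - pb_below k q 0 j \<le> real (k choose j) * q ^ j"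
  proof (induction k arbitrary: j)
    case 0
    show ?case by (cases j) auto
  next
    case (Suc k)
    show ?case
    proof (cases j)
      case 0
      then show ?thesis by simp
    next
      case j: (Suc i)
      have "1 - pb_below (Suc k) q 0 j = (1 - q) * (1 - pb_below k q 0 j) + q * (1 - pb_below k q 0 i)"
        by (simp add: j algebra_simps)
      also have "\<dots> \<le> 1 * (1 - pb_below k q 0 j) + q * (1 - pb_below k q 0 i)"
        using assms pb_below_bounds[OF assms order_refl] by (intro add_right_mono mult_right_mono) auto
      also have "\<dots> \<le> 1 * (real (k choose j) * q ^ j) + q * (real (k choose i) * q ^ i)"
        using assms by (intro add_mono mult_left_mono Suc) auto
      also have "\<dots> = real (Suc k choose j) * q ^ j" by (simp add: j algebra_simps)
      finally show ?thesis .
    qed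
  qed
  also have "\<dots> \<le> (real k ^ j / fact j) * q ^ j"
  proof (intro mult_right_mono)
    have "real (fact j * (k choose j)) \<le> real (k ^ j)"
      by (simp only: of_nat_le_iff) (metis binomial_fact_pow mult.commute)
    then show "real (k choose j) \<le> real k ^ j / fact j" by (simp add: field_simps)
  qed (use assms in auto)
  finally show ?thesis by (simp add: power_mult_distrib)
qed

section \<open>The constants\<close>

lemma h_2_3_eq_iff: "2 * h 2 x = 3 * h 3 x \<longleftrightarrow> (1 + x + 3 / 2 * x\<^sup>2) * exp (- x) = 1"
proof -
  have "2 * h 2 x = 2 - 2 * exp (- x) * (1 + x)" "3 * h 3 x = 3 - 3 * exp (- x) * (1 + x + x\<^sup>2 / 2)"
    by (simp_all add: h_def eval_nat_numeral)
  then show ?thesis by (auto simp: algebra_simps)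
qed

text \<open>The equation is \<open>f x = 1\<close> for a function that starts at 1, rises up to 4/3
  and strictly falls afterwards. So it has at most one positive root, located by the sign of
  \<open>f - 1\<close> at 2.63 and 2.7.\<close>

lemma crossing_ex1: "\<exists>!c. c > 0 \<and> 2 * h 2 c = 3 * h 3 c"
  and crossing_bounds: "c > 0 \<Longrightarrow> 2 * h 2 c = 3 * h 3 c \<Longrightarrow> 2.63 \<le> c \<and> c \<le> 2.7"
proof -
  define f :: "real \<Rightarrow> real" where "f x = (1 + x + 3 / 2 * x\<^sup>2) * exp (- x)" for x
  have f': "(f has_real_derivative exp (- x) * x * (2 - 3 / 2 * x)) (at x)" for x
    unfolding f_def by (auto intro!: derivative_eq_intros simp: field_simps power2_eq_square)
  have cont: "continuous_on S f" for S
    by (auto intro!: DERIV_isCont[OF f'] continuous_at_imp_continuous_on)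
  have inc: "f x > f 0" if "0 < x" "x \<le> 4 / 3" for x
  proof (rule DERIV_pos_imp_increasing_open[OF that(1) _ cont])
    fix y assume "0 < y" "y < x"
    then have "0 < exp (- y) * y * (2 - 3 / 2 * y)" using that by simp
    with f' show "\<exists>z. (f has_real_derivative z) (at y) \<and> 0 < z" by blast
  qed
  have dec: "f y < f x" if "4 / 3 \<le> x" "x < y" for x y
  proof (rule DERIV_neg_imp_decreasing_open[OF that(2) _ cont])
    fix z assume "x < z" "z < y"
    then have "exp (- z) * z * (2 - 3 / 2 * z) < 0" using that by (intro mult_pos_neg) auto
    with f' show "\<exists>w. (f has_real_derivative w) (at z) \<and> w < 0" by blast
  qed
  have f0: "f 0 = 1" by (simp add: f_def)
  have "(\<Sum>i<12. (-2.63) ^ i / fact i) \<le> exp (-2.63 :: real)"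
    by (rule exp_partial_sum_le) simp
  then have "1 / 14 \<le> exp (-2.63 :: real)"
    by (simp add: lessThan_nat_numeral lessThan_Suc fact_numeral power_divide)
  \<comment> \<open>The polynomial factor of \<open>f\<close> is 14.00535 at 2.63, just above 14. At
    2.7 it is 14.635, below 14.7.\<close>
  then have lo: "1 < f 2.63" by (simp add: f_def power2_eq_square)
  have "(\<Sum>i<10. 2.7 ^ i / fact i) \<le> exp (2.7 :: real)"
    by (rule exp_partial_sum_le) simp
  then have "14.7 \<le> exp (2.7 :: real)"
    by (simp add: lessThan_nat_numeral lessThan_Suc fact_numeral power_divide)
  then have hi: "f 2.7 < 1" by (simp add: f_def power2_eq_square exp_minus field_simps)
  have root: "4 / 3 < c \<and> f c = 1" if "c > 0" "2 * h 2 c = 3 * h 3 c" for c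
  proof -
    have "f c = 1" using that(2) by (simp add: h_2_3_eq_iff f_def)
    with that(1) inc[of c] f0 show ?thesis by fastforce
  qed
  show "2.63 \<le> c \<and> c \<le> 2.7" if "c > 0" "2 * h 2 c = 3 * h 3 c" for c
    using root[OF that] dec[of c "2.63"] dec[of "2.7" c] lo hi by (auto simp: not_le[symmetric])
  have "\<exists>x\<ge>2.63. x \<le> 2.7 \<and> f x = 1"
    using lo hi by (intro IVT2) (auto intro: DERIV_isCont[OF f'])
  then obtain c where c: "2.63 \<le> c" "f c = 1" by auto
  show "\<exists>!c. c > 0 \<and> 2 * h 2 c = 3 * h 3 c"
  proof (rule ex1I[of _ c])
    show "c > 0 \<and> 2 * h 2 c = 3 * h 3 c"
      using c by (simp add: h_2_3_eq_iff f_def)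
    fix d assume "d > 0 \<and> 2 * h 2 d = 3 * h 3 d"
    then have "4 / 3 < d" "f d = 1" using root by auto
    then show "d = c" using c dec[of d c] dec[of c d] by (cases d c rule: linorder_cases) auto
  qed
qed

lemma cstar: "cstar > 0" "2 * h 2 cstar = 3 * h 3 cstar"
  using theI'[OF crossing_ex1] by (auto simp: cstar_def)

lemma cstar_bounds: "2.63 \<le> cstar" "cstar \<le> 2.7"
  using crossing_bounds[OF cstar] by auto

text \<open>The defining equation makes the exponential polynomial at \<open>cstar\<close>, so
  \<open>rho\<close> and every \<open>h d cstar\<close> become rational functions of
  \<open>cstar\<close>.\<close>

lemma exp_cstar: "exp cstar = 1 + cstar + 3 / 2 * cstar\<^sup>2"
  using cstar(2) by (simp add: h_2_3_eq_iff exp_minus field_simps)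

lemma h_cstar: "h d cstar = 1 - (\<Sum>i<d. cstar ^ i / fact i) / (1 + cstar + 3 / 2 * cstar\<^sup>2)"
  by (simp add: h_def exp_minus exp_cstar field_simps)

lemma rho_cstar: "rho * cstar = 2 * h 2 cstar" "rho * cstar = 3 * h 3 cstar"
  using cstar by (simp_all add: rho_def)

lemma rho_cstar_eq: "rho * cstar = 3 * cstar\<^sup>2 / (1 + cstar + 3 / 2 * cstar\<^sup>2)"
proof -
  have "1 + cstar + 3 / 2 * cstar\<^sup>2 > 0" using cstar(1) by (simp add: add_pos_nonneg)
  then show ?thesis
  unfolding rho_cstar(1) h_cstar by (simp add: eval_nat_numeral field_simps)
qed

lemma rho_bounds: "0 \<le> rho" "rho \<le> 0.564"
proof -
  define E where "E = 1 + cstar + 3 / 2 * cstar\<^sup>2"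
  have E: "E > 0" using cstar(1) by (simp add: E_def add_pos_nonneg)
  have r: "rho = 3 * cstar / E"
    using rho_cstar_eq cstar(1) E unfolding E_def[symmetric] by (simp add: divide_simps power2_eq_square)
  have "3 * cstar \<le> 0.564 * E"
  proof -
    \<comment> \<open>Up to the positive remainder \<open>0.00907 - 0.00002 * cstar\<close>, this
      product is \<open>0.564 * E - 3 * cstar\<close>.\<close>
    have "0 \<le> (cstar - 2.63) * (0.846 * cstar - 0.211)"
      using cstar_bounds by (intro mult_nonneg_nonneg) auto
    then show ?thesis using cstar_bounds by (simp add: E_def power2_eq_square field_simps)
  qed
  then show "rho \<le> 0.564"
    unfolding r using E by (simp only: pos_divide_le_eq)
  show "0 \<le> rho"
    unfolding r using E cstar(1) by simp
qed

text \<open>With the denominator \<open>E\<close> cleared, the gap is an explicit polynomial in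
  \<open>cstar\<close>, nonnegative from 2.63 on. The sizes 2 and 3 give equality.\<close>

lemma h_cstar_le_rho:
  assumes "j \<le> 6"
  shows "real j * h j cstar \<le> rho * cstar"
proof -
  let ?c = cstar
  define E where "E = 1 + ?c + 3 / 2 * ?c\<^sup>2"
  have E: "E > 0" using cstar(1) by (simp add: E_def add_pos_nonneg)
  have key: ?thesis if "real j * (E - (\<Sum>i<j. ?c ^ i / fact i)) \<le> 3 * ?c\<^sup>2"
  proof -
    have "real j * h j ?c = real j * (E - (\<Sum>i<j. ?c ^ i / fact i)) / E"
      unfolding h_cstar E_def[symmetric] using E by (simp add: divide_simps)
    then show ?thesis
      unfolding rho_cstar_eq E_def[symmetric] using E that by (simp add: divide_right_mono)
  qed
  have c: "2.63 \<le> ?c" "2.63\<^sup>2 \<le> ?c\<^sup>2" "2.63 ^ 3 \<le> ?c ^ 3"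
    using cstar_bounds(1) by (auto intro!: power_mono)
  consider "j = 0" | "j = 1" | "j = 2" | "j = 3" | "j = 4" | "j = 5" | "j = 6"
    using assms by linarith
  then show ?thesis
  proof cases
    case 1
    then show ?thesis by (intro key) simp
  next
    case 2
    have "real j * (E - (\<Sum>i<j. ?c ^ i / fact i)) = 3 * ?c\<^sup>2 - ?c * (3 / 2 * ?c - 1)"
      by (simp add: 2 E_def power2_eq_square field_simps)
    then show ?thesis using c by (intro key) simp
  next
    case 3
    then show ?thesis using rho_cstar(1) by simp
  next
    case 4
    then show ?thesis using rho_cstar(2) by simp
  next
    case 5
    have "real j * (E - (\<Sum>i<j. ?c ^ i / fact i)) = 3 * ?c\<^sup>2 - ?c\<^sup>2 * (2 / 3 * ?c - 1)"
      by (simp add: 5 E_def lessThan_nat_numeral lessThan_Suc fact_numeral eval_nat_numeral field_simps)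
    then show ?thesis using c by (intro key) simp
  next
    case 6
    have "real j * (E - (\<Sum>i<j. ?c ^ i / fact i)) = 3 * ?c\<^sup>2 - ?c\<^sup>2 * (5 / 6 * ?c + 5 / 24 * ?c\<^sup>2 - 2)"
      by (simp add: 6 E_def lessThan_nat_numeral lessThan_Suc fact_numeral eval_nat_numeral field_simps)
    moreover have "0 \<le> ?c\<^sup>2 * (5 / 6 * ?c + 5 / 24 * ?c\<^sup>2 - 2)"
      using c by (intro mult_nonneg_nonneg) (auto simp: power2_eq_square)
    ultimately show ?thesis by (intro key) linarith
  next
    case 7
    have "real j * (E - (\<Sum>i<j. ?c ^ i / fact i)) = 3 * ?c\<^sup>2 - ?c\<^sup>2 * (?c + ?c\<^sup>2 / 4 + ?c ^ 3 / 20 - 3)"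
      by (simp add: 7 E_def lessThan_nat_numeral lessThan_Suc fact_numeral eval_nat_numeral field_simps)
    moreover have "0 \<le> ?c\<^sup>2 * (?c + ?c\<^sup>2 / 4 + ?c ^ 3 / 20 - 3)"
      using c by (intro mult_nonneg_nonneg) (auto simp: eval_nat_numeral)
    ultimately show ?thesis by (intro key) linarith
  qed
qed

section \<open>Bundle prices for Bernoulli values\<close>

lemma exp_partial_sum_le_geometric:
  fixes x r :: real
  assumes "1 < r" "r * real m \<le> x" "n \<le> m" "0 < x"
  shows "(\<Sum>i<Suc n. x ^ i / fact i) \<le> r / (r - 1) * (x ^ n / fact n)"
  using assms(3)
proof (induction n)
  case 0
  then show ?case using assms by (simp add: field_simps)
next
  case (Suc n)
  \<comment> \<open>Each term is at least \<open>r\<close> times its predecessor, so the sum is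
    dominated by a geometric series read backwards from the last term.\<close>
  have "r * real (Suc n) \<le> x"
    using assms Suc.prems by (meson less_eq_real_def mult_left_mono of_nat_le_iff order_trans zero_less_one)
  then have *: "real (Suc n) / x \<le> 1 / r"
    using assms by (simp add: field_simps)
  have "(\<Sum>i<Suc (Suc n). x ^ i / fact i) \<le> r / (r - 1) * (x ^ n / fact n) + x ^ Suc n / fact (Suc n)"
    using Suc by simp
  also have "x ^ n / fact n = real (Suc n) / x * (x ^ Suc n / fact (Suc n))"
    using assms(4) by (simp add: fact_Suc del: of_nat_Suc)
  also have "r / (r - 1) * (real (Suc n) / x * (x ^ Suc n / fact (Suc n))) + x ^ Suc n / fact (Suc n)
     = (r / (r - 1) * (real (Suc n) / x) + 1) * (x ^ Suc n / fact (Suc n))"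
    by (simp only: distrib_right mult_1_left mult.assoc)
  also have "\<dots> \<le> (r / (r - 1) * (1 / r) + 1) * (x ^ Suc n / fact (Suc n))"
    using assms * by (intro mult_right_mono add_right_mono mult_left_mono) auto
  also have "r / (r - 1) * (1 / r) + 1 = r / (r - 1)"
    using assms by (simp add: field_simps)
  finally show ?case .
qed

text \<open>The ratio of the two sides is \<open>r * exp (- r) * (1 + 1 / m) ^ m\<close>. It is at
  most 1 because \<open>(1 + 1 / m) ^ m \<le> exp 1\<close> and
  \<open>r \<le> exp (r - 1)\<close>.\<close>

lemma poisson_mass_proportional_decreasing:
  fixes r :: real
  assumes "0 < r" "0 < m"
  shows "exp (- (r * real (Suc m))) * (r * real (Suc m)) ^ Suc m / fact (Suc m)
    \<le> exp (- (r * real m)) * (r * real m) ^ m / fact m"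
proof -
  have "(1 + 1 / real m) ^ m \<le> exp (1 / real m) ^ m"
    using exp_ge_add_one_self by (intro power_mono) auto
  also have "\<dots> = exp 1"
    using assms by (simp flip: exp_of_nat_mult)
  finally have "(real (Suc m) / real m) ^ m \<le> exp 1"
    using assms by (simp add: field_simps)
  then have *: "real (Suc m) ^ m \<le> exp 1 * real m ^ m"
    using assms by (simp add: power_divide divide_le_eq)
  have r: "r \<le> exp (r - 1)" using exp_ge_add_one_self[of "r - 1"] by simp
  have "exp (- (r * real (Suc m))) * (r * real (Suc m)) ^ Suc m / fact (Suc m) =
     exp (- (r * real (Suc m))) * (r * (r ^ m * real (Suc m) ^ m)) / fact m"
    by (simp add: power_mult_distrib field_simps del: of_nat_Suc)
  also have "\<dots> \<le> exp (- (r * real (Suc m))) * (exp (r - 1) * (r ^ m * (exp 1 * real m ^ m))) / fact m"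
    using assms r * by (intro divide_right_mono mult_left_mono mult_mono) auto
  also have "\<dots> = (exp (- (r * real (Suc m))) * exp (r - 1) * exp 1) * (r ^ m * real m ^ m) / fact m"
    by (simp add: mult_ac)
  also have "exp (- (r * real (Suc m))) * exp (r - 1) * exp 1 = exp (- (r * real m))"
    by (simp add: algebra_simps flip: exp_add)
  finally show ?thesis by (simp add: power_mult_distrib)
qed

lemma poisson_mass_proportional_le:
  fixes r :: real
  assumes "0 < r" "0 < n" "n \<le> m"
  shows "exp (- (r * real m)) * (r * real m) ^ m / fact m \<le> exp (- (r * real n)) * (r * real n) ^ n / fact n"
  using assms(3)
proof (induction m rule: dec_induct)
  case (step m)
  then show ?case
    using poisson_mass_proportional_decreasing[OF assms(1), of m] assms(2) by simp
qed simp

lemma h_proportional_ge: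
  fixes r :: real
  assumes "1 < r" "0 < n" "n \<le> m"
    and "r / (r - 1) * (exp (- (r * real n)) * (r * real n) ^ n / fact n) \<le> 1 - s"
  shows "s \<le> h (Suc m) (r * real m)"
proof -
  have "exp (- (r * real m)) * (\<Sum>i<Suc m. (r * real m) ^ i / fact i)
     \<le> exp (- (r * real m)) * (r / (r - 1) * ((r * real m) ^ m / fact m))"
    using assms by (intro mult_left_mono exp_partial_sum_le_geometric[where m = m]) auto
  also have "\<dots> = r / (r - 1) * (exp (- (r * real m)) * (r * real m) ^ m / fact m)"
    by simp
  also have "\<dots> \<le> r / (r - 1) * (exp (- (r * real n)) * (r * real n) ^ n / fact n)"
    by (rule mult_left_mono[OF poisson_mass_proportional_le]) (use assms in auto)
  finally show ?thesis using assms(4) by (simp add: h_def)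
qed

text \<open>Here \<open>m \<approx> x / 1.5\<close>: by concavity it is enough to bound the tail at \<open>x = 1.5 m\<close> and
  \<open>x = 1.625 m\<close>, and by the monotonicity above only for \<open>m = 12\<close>.\<close>
lemma h_ge_large:
  assumes "18 \<le> x"
  obtains m where "12 \<le> m" "1.5 * real m \<le> x" "0.564 * x \<le> real (Suc m) * h (Suc m) x"
proof -
  define m where "m = nat \<lfloor>x / 1.5\<rfloor>"
  have m: "12 \<le> m" "1.5 * real m \<le> x" "x \<le> 1.5 * (real m + 1)"
    using assms unfolding m_def by (auto simp: le_nat_iff le_floor_iff) linarith+
  have "(\<Sum>i<8. 1 ^ i / fact i) \<le> exp (1 :: real)"
    by (rule exp_partial_sum_le) simp
  then have e1: "2.7 \<le> exp (1 :: real)"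
    by (simp add: lessThan_nat_numeral lessThan_Suc fact_numeral)
  have e18: "(2.7::real) ^ 18 \<le> exp 18"
    using power_mono[of "2.7" "exp 1 :: real" 18] exp_of_nat_mult[of 18 "1::real"] e1 by simp
  have e19: "(2.7::real) ^ 19 * 1.5 \<le> exp 19.5"
  proof -
    have "(2.7::real) ^ 19 \<le> exp 19"
      using power_mono[of "2.7" "exp 1 :: real" 19] exp_of_nat_mult[of 19 "1::real"] e1 by simp
    moreover have "1.5 \<le> exp (0.5::real)" using exp_ge_add_one_self[of "0.5"] by simp
    ultimately have "(2.7::real) ^ 19 * 1.5 \<le> exp 19 * exp 0.5" by (intro mult_mono) auto
    then show ?thesis by (simp flip: exp_add)
  qed
  \<comment> \<open>Here 0.846 is 0.564 * 1.5, and 0.9165 below is 0.564 * 1.625. The factor 1.625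
    is 1.5 * 13/12, so \<open>x \<le> 1.5 * (m + 1) \<le> 1.625 * m\<close> once
    \<open>12 \<le> m\<close>.\<close>
  have a: "0.846 \<le> h (Suc m) (1.5 * real m)"
  proof (rule h_proportional_ge[of _ 12])
    show "1.5 / (1.5 - 1) * (exp (- (1.5 * real 12)) * (1.5 * real 12) ^ 12 / fact 12) \<le> 1 - (0.846::real)"
      using e18 by (simp add: exp_minus fact_numeral field_simps)
  qed (use m in auto)
  have b: "0.9165 \<le> h (Suc m) (1.625 * real m)"
  proof (rule h_proportional_ge[of _ 12])
    show "1.625 / (1.625 - 1) * (exp (- (1.625 * real 12)) * (1.625 * real 12) ^ 12 / fact 12) \<le> 1 - (0.9165::real)"
      using e19 by (simp add: exp_minus fact_numeral field_simps power_divide)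
  qed (use m in auto)
  have "0.564 / real (Suc m) * x \<le> h (Suc m) x"
  proof (rule h_ge_linear_between[of m "1.5 * real m" x "1.625 * real m"])
    have "0.564 / real (Suc m) * (1.5 * real m) = 0.846 * (real m / real (Suc m))" by simp
    also have "\<dots> \<le> 0.846" by (simp add: field_simps)
    finally show "0.564 / real (Suc m) * (1.5 * real m) \<le> h (Suc m) (1.5 * real m)" using a by simp
    have "0.564 / real (Suc m) * (1.625 * real m) = 0.9165 * (real m / real (Suc m))" by simp
    also have "\<dots> \<le> 0.9165" by (simp add: field_simps)
    finally show "0.564 / real (Suc m) * (1.625 * real m) \<le> h (Suc m) (1.625 * real m)" using b by simp
  qed (use m in auto)
  then have "0.564 * x \<le> real (Suc m) * h (Suc m) x" by (simp add: field_simps del: of_nat_Suc)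
  with m that show ?thesis by blast
qed

text \<open>The side condition on \<open>m\<close> keeps it below the mean of the binomial with one trial removed, as the
  comparison of the binomial with the Poisson tail requires.\<close>
lemma poisson_tail_revenue:
  assumes "0 \<le> x"
  obtains m where "rho * x \<le> real (Suc m) * h (Suc m) x"
    "m = 0 \<or> m = 1 \<and> 1.25 \<le> x \<or> m = 2 \<and> 2.63 \<le> x \<or> (3 \<le> m \<and> real (Suc m) \<le> x)"
proof -
  have ends: "rho / real j * a \<le> h j a" if "0.564 / real j * a \<le> h j a" "0 \<le> a" for j a
  proof -
    have "rho / real j * a \<le> 0.564 / real j * a"
      using rho_bounds that by (intro mult_right_mono divide_right_mono) auto
    with that show ?thesis by simp
  qed
  have seg: "rho * x \<le> real (Suc d) * h (Suc d) x"
    if "real d \<le> a" "a \<le> x" "x \<le> b"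
      "rho / real (Suc d) * a \<le> h (Suc d) a" "rho / real (Suc d) * b \<le> h (Suc d) b" for d a b
    using h_ge_linear_between[OF that] by (simp add: field_simps del: of_nat_Suc)
  \<comment> \<open>At \<open>cstar\<close> both bounds are equalities, so they come from the
    definition of \<open>rho\<close> and not from 0.564.\<close>
  have c: "rho / 2 * cstar \<le> h 2 cstar" "rho / 3 * cstar \<le> h 3 cstar"
    using rho_cstar by auto
  have c': "rho / 2 * 1.25 \<le> h 2 1.25" "rho / 3 * 4 \<le> h 3 4"
    using ends[of 2 "1.25"] ends[of 3 4] h_endpoint_bounds(2,3) by simp_all
  \<comment> \<open>The bundle sizes \<open>Suc m\<close> on these intervals are 1, 2, 3, 4, 5, 7,
    11, and then roughly \<open>x / 1.5\<close>.\<close>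
  consider "x \<le> 1.25" | "1.25 \<le> x" "x \<le> cstar" | "cstar \<le> x" "x \<le> 4" | "4 \<le> x" "x \<le> 6"
    | "6 \<le> x" "x \<le> 7.5" | "7.5 \<le> x" "x \<le> 11.5" | "11.5 \<le> x" "x \<le> 18" | "18 \<le> x"
    by linarith
  then show ?thesis
  proof cases
    case 1
    then show ?thesis using assms h_endpoint_bounds(1)
      by (intro that[of 0] seg[of _ 0 "1.25"] ends) auto
  next
    case 2
    then show ?thesis using c(1) c'(1) seg[of 1 "1.25" cstar]
      by (intro that[of 1]) (auto simp: numeral_2_eq_2)
  next
    case 3
    then show ?thesis using c(2) c'(2) cstar_bounds seg[of 2 cstar 4]
      by (intro that[of 2]) (auto simp: numeral_3_eq_3)
  next
    case 4
    then show ?thesis using h_endpoint_bounds(4,5)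
      by (intro that[of 3] seg[of _ 4 6] ends) auto
  next
    case 5
    then show ?thesis using h_endpoint_bounds(6,7)
      by (intro that[of 4] seg[of _ 6 "7.5"] ends) auto
  next
    case 6
    then show ?thesis using h_endpoint_bounds(8,9)
      by (intro that[of 6] seg[of _ "7.5" "11.5"] ends) auto
  next
    case 7
    then show ?thesis using h_endpoint_bounds(10,11)
      by (intro that[of 10] seg[of _ "11.5" 18] ends) auto
  next
    case 8
    then obtain m where m: "12 \<le> m" "1.5 * real m \<le> x" "0.564 * x \<le> real (Suc m) * h (Suc m) x"
      by (rule h_ge_large)
    have "rho * x \<le> 0.564 * x" using rho_bounds assms by (intro mult_right_mono)
    then have "rho * x \<le> real (Suc m) * h (Suc m) x" using m(3) by linarith
    with m(1,2) show ?thesis by (intro that[of m]) auto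
  qed
qed

text \<open>The gap is \<open>q\<close> times a polynomial, written as a sum of terms that are
  visibly nonnegative on the chosen range of \<open>q\<close>. Larger \<open>q\<close> calls for
  larger \<open>j\<close>.\<close>

lemma binomial_tail_revenue_small:
  assumes "0 \<le> q" "q \<le> 1" "1 \<le> k" "k \<le> 4"
  shows "\<exists>j. 0.564 * (real k * q) \<le> real j * (1 - pb_below k q 0 j)"
proof -
  have "k = 1 \<or> k = 2 \<or> k = 3 \<or> k = 4"
    using assms(3,4) by linarith
  then consider "k = 1" | "k = 2" "q \<le> 0.7" | "k = 2" "0.7 \<le> q" | "k = 3" "q \<le> 0.5" | "k = 3" "0.5 \<le> q"
    | "k = 4" "q \<le> 0.36" | "k = 4" "0.36 \<le> q" "q \<le> 0.6" | "k = 4" "0.6 \<le> q"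
    using linear[of q "0.7"] linear[of q "0.5"] linear[of q "0.36"] linear[of q "0.6"] by blast
  then show ?thesis
  proof cases
    case 1
    then show ?thesis using assms by (intro exI[of _ 1]) simp
  next
    case k: 2
    have "real 1 * (1 - pb_below k q 0 1) - 0.564 * (real k * q) = q * (0.872 - q)"
      by (simp add: k(1) eval_nat_numeral field_simps)
    moreover have "0 \<le> q * (0.872 - q)"
      using k assms by (intro mult_nonneg_nonneg add_nonneg_nonneg) auto
    ultimately show ?thesis by (intro exI[of _ 1]) linarith
  next
    case k: 3
    have "real 2 * (1 - pb_below k q 0 2) - 0.564 * (real k * q) = q * (2 * q - 1.128)"
      by (simp add: k(1) eval_nat_numeral field_simps)
    moreover have "0 \<le> q * (2 * q - 1.128)"
      using k assms by (intro mult_nonneg_nonneg add_nonneg_nonneg) auto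
    ultimately show ?thesis by (intro exI[of _ 2]) linarith
  next
    case k: 4
    have "real 1 * (1 - pb_below k q 0 1) - 0.564 * (real k * q) = q * ((0.5 - q) * (2.5 - q) + 0.058)"
      by (simp add: k(1) eval_nat_numeral field_simps)
    moreover have "0 \<le> q * ((0.5 - q) * (2.5 - q) + 0.058)"
      using k assms by (intro mult_nonneg_nonneg add_nonneg_nonneg) auto
    ultimately show ?thesis by (intro exI[of _ 1]) linarith
  next
    case k: 5
    have "real 2 * (1 - pb_below k q 0 2) - 0.564 * (real k * q) = q * (4 * (1 - q) * (q - 0.5) + 0.308)"
      by (simp add: k(1) eval_nat_numeral field_simps)
    moreover have "0 \<le> q * (4 * (1 - q) * (q - 0.5) + 0.308)"
      using k assms by (intro mult_nonneg_nonneg add_nonneg_nonneg) auto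
    ultimately show ?thesis by (intro exI[of _ 2]) linarith
  next
    case k: 6
    have "real 1 * (1 - pb_below k q 0 1) - 0.564 * (real k * q) = q * (4 * (q - 0.36)\<^sup>2 + (0.36 - q) * (0.36 + q) * q + (1.2256 - 3.2496 * q))"
      by (simp add: k(1) eval_nat_numeral field_simps)
    moreover have "0 \<le> q * (4 * (q - 0.36)\<^sup>2 + (0.36 - q) * (0.36 + q) * q + (1.2256 - 3.2496 * q))"
      using k assms by (intro mult_nonneg_nonneg add_nonneg_nonneg) auto
    ultimately show ?thesis by (intro exI[of _ 1]) linarith
  next
    case k: 7
    have "real 2 * (1 - pb_below k q 0 2) - 0.564 * (real k * q) = q * (6 * (q - 0.5)\<^sup>2 * (q + 1) + 16 * (q - 0.36) * (0.6 - q) + (1.14 * q - 0.3))"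
      by (simp add: k(1) eval_nat_numeral field_simps)
    moreover have "0 \<le> q * (6 * (q - 0.5)\<^sup>2 * (q + 1) + 16 * (q - 0.36) * (0.6 - q) + (1.14 * q - 0.3))"
      using k assms by (intro mult_nonneg_nonneg add_nonneg_nonneg) auto
    ultimately show ?thesis by (intro exI[of _ 2]) linarith
  next
    case k: 8
    have "real 3 * (1 - pb_below k q 0 3) - 0.564 * (real k * q) = q * (9 * ((q - 0.6) * (q + 0.6)) * (1 - q) + 3 * (q - 0.54)\<^sup>2 + 0.1092)"
      by (simp add: k(1) eval_nat_numeral field_simps)
    moreover have "0 \<le> q * (9 * ((q - 0.6) * (q + 0.6)) * (1 - q) + 3 * (q - 0.54)\<^sup>2 + 0.1092)"
      using k assms by (intro mult_nonneg_nonneg add_nonneg_nonneg) auto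
    ultimately show ?thesis by (intro exI[of _ 3]) linarith
  qed
qed

lemma binomial_tail_revenue:
  assumes "0 \<le> q" "q \<le> 1" "1 \<le> k"
  shows "\<exists>j. rho * (real k * q) \<le> real j * (1 - pb_below k q 0 j)"
proof (cases "k \<le> 4")
  case True
  have "rho * (real k * q) \<le> 0.564 * (real k * q)"
    using rho_bounds assms by (intro mult_right_mono) auto
  with binomial_tail_revenue_small[OF assms True] show ?thesis
    using order_trans by blast
next
  case False
  obtain n where n: "k = Suc n" "4 \<le> n" using False by (cases k) auto
  obtain m where m: "rho * (real k * q) \<le> real (Suc m) * h (Suc m) (real k * q)"
    "m = 0 \<or> m = 1 \<and> 1.25 \<le> real k * q \<or> m = 2 \<and> 2.63 \<le> real k * q \<or> (3 \<le> m \<and> real (Suc m) \<le> real k * q)"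
    using poisson_tail_revenue[of "real k * q"] assms by auto
  \<comment> \<open>Removing one of at least five trials costs at most a fifth of the mean: 1.25
    still leaves 1, and 2.63 leaves more than 2. For \<open>3 \<le> m\<close> the loss is only
    \<open>q \<le> 1\<close>.\<close>
  have kq: "real k * q * 4 \<le> 5 * (real n * q)"
    using n assms mult_right_mono[of 4 "real n" q] by (simp add: algebra_simps)
  have "real m \<le> real n * q"
    using m(2)
  proof (elim disjE conjE)
    assume "3 \<le> m" "real (Suc m) \<le> real k * q"
    then show ?thesis using n assms by (simp add: algebra_simps)
  qed (use kq n assms in auto)
  from binomial_below_le_poisson[OF assms(1,2) this]
  have "real (Suc m) * h (Suc m) (real k * q) \<le> real (Suc m) * (1 - pb_below k q 0 (Suc m))"
    unfolding n(1) by (intro mult_left_mono) (auto simp del: of_nat_Suc)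
  with m(1) show ?thesis by (intro exI[of _ "Suc m"]) linarith
qed

section \<open>Revenue\<close>

lemma ennreal_binomial_tail_Suc:
  assumes "0 \<le> q" "q \<le> 1"
  shows "ennreal (1 - pb_below (Suc k) q 0 j) =
    ennreal (1 - pb_below k q 0 (j - 1)) * ennreal q + ennreal (1 - pb_below k q 0 j) * ennreal (1 - q)"
proof -
  have "1 - pb_below (Suc k) q 0 j = (1 - pb_below k q 0 (j - 1)) * q + (1 - pb_below k q 0 j) * (1 - q)"
    by (simp add: algebra_simps)
  then show ?thesis
    using assms pb_below_bounds[OF assms order_refl, of k]
    by (simp add: ennreal_plus ennreal_mult)
qed

definition sum_tail :: "real measure \<Rightarrow> nat \<Rightarrow> real \<Rightarrow> real" where
  "sum_tail F k y = measure (PiM {..<k} (\<lambda>_. F)) {x \<in> space (PiM {..<k} (\<lambda>_. F)). y \<le> (\<Sum>i<k. x i)}"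

lemma sum_tail_0: "sum_tail F 0 y = (if y \<le> 0 then 1 else 0)"
proof -
  have "{x \<in> space (PiM {..<0::nat} (\<lambda>_. F)). y \<le> (\<Sum>i<0. x i)} = (if y \<le> 0 then {\<lambda>_. undefined} else {})"
    by (auto simp: space_PiM)
  then show ?thesis
    by (simp add: sum_tail_def PiM_empty measure_def emeasure_count_space_finite)
qed

lemma sum_tail_bounds:
  assumes "prob_space F"
  shows "0 \<le> sum_tail F k y" "sum_tail F k y \<le> 1"
  using assms by (auto simp: sum_tail_def intro!: prob_space.prob_le_1 prob_space_PiM)

lemma sum_tail_antimono:
  assumes "prob_space F" "sets F = sets borel" "y \<le> z"
  shows "sum_tail F k z \<le> sum_tail F k y"
proof -
  have "finite_measure (PiM {..<k} (\<lambda>_. F))"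
    using assms(1) by (intro prob_space.finite_measure prob_space_PiM)
  moreover note [measurable_cong] = assms(2)
  ultimately show ?thesis unfolding sum_tail_def using assms(3)
    by (intro finite_measure.finite_measure_mono) auto
qed

text \<open>Fubini, integrating out the last coordinate. This is the analogue of the recursion of
  \<open>pb_below\<close> for arbitrary values.\<close>

lemma sum_tail_Suc:
  assumes "prob_space F" "sets F = sets borel"
  shows "ennreal (sum_tail F (Suc k) y) = (\<integral>\<^sup>+ t. ennreal (sum_tail F k (y - t)) \<partial>F)"
proof -
  have "product_sigma_finite (\<lambda>_::nat. F)"
    using assms(1) by (simp add: product_sigma_finite_def prob_space_imp_sigma_finite)
  note insert_rev = product_sigma_finite.product_nn_integral_insert_rev[OF this]
  note [measurable_cong] = assms(2)
  let ?P = "\<lambda>k. PiM {..<k} (\<lambda>_. F)"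
  let ?A = "\<lambda>k y. {x \<in> space (?P k). y \<le> (\<Sum>i<k. x i)}"
  have P: "prob_space (?P k)" for k using assms by (intro prob_space_PiM)
  have E: "ennreal (sum_tail F k y) = emeasure (?P k) (?A k y)" for k y
    using P[of k] unfolding sum_tail_def
    by (simp add: finite_measure.emeasure_eq_measure prob_space.finite_measure)
  have [measurable]: "?A k y \<in> sets (?P k)" for k y
    by measurable
  have "ennreal (sum_tail F (Suc k) y) = (\<integral>\<^sup>+ x. indicator (?A (Suc k) y) x \<partial>?P (Suc k))"
    by (simp add: E)
  also have "\<dots> = (\<integral>\<^sup>+ t. (\<integral>\<^sup>+ x. indicator (?A (Suc k) y) (x(k := t)) \<partial>?P k) \<partial>F)"
    using insert_rev[of "{..<k}" k "indicator (?A (Suc k) y)"]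
    by (simp add: lessThan_Suc)
  also have "\<dots> = (\<integral>\<^sup>+ t. (\<integral>\<^sup>+ x. indicator (?A k (y - t)) x \<partial>?P k) \<partial>F)"
  proof (intro nn_integral_cong)
    fix t x assume t: "t \<in> space F" and x: "x \<in> space (?P k)"
    have "x(k := t) \<in> space (?P (Suc k))"
      using t x by (auto simp: space_PiM PiE_iff extensional_def less_Suc_eq)
    then show "indicator (?A (Suc k) y) (x(k := t)) = (indicator (?A k (y - t)) x :: ennreal)"
      using x by (auto simp: indicator_def algebra_simps)
  qed
  also have "\<dots> = (\<integral>\<^sup>+ t. ennreal (sum_tail F k (y - t)) \<partial>F)"
    by (simp add: E)
  finally show ?thesis .
qed

text \<open>A value of at least \<open>p\<close> is counted as \<open>p\<close> and any other as 0.
  The induction conditions on the last value.\<close>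

lemma sum_tail_ge_binomial:
  assumes "nonneg_dist F" "0 \<le> p"
  shows "1 - pb_below k (measure F {p..}) 0 j \<le> sum_tail F k (real j * p)"
proof -
  have F: "prob_space F" "sets F = sets borel" "measure F {0..} = 1"
    using assms(1) by (auto simp: nonneg_dist_def)
  have fin: "finite_measure F"
    using F(1) by (rule prob_space.finite_measure)
  note [measurable_cong] = F(2)
  define q where "q = measure F {p..}"
  have q: "0 \<le> q" "q \<le> 1" by (auto simp: q_def intro: prob_space.prob_le_1[OF F(1)])
  have "measure F ({0..} - {p..}) = measure F {0..} - measure F {p..}"
    using assms(2) by (intro finite_measure.finite_measure_Diff[OF fin]) (auto simp: F(2))
  then have q': "measure F {0..<p} = 1 - q"
    by (simp add: q_def F(3) Diff_eq) (simp add: atLeastLessThan_def lessThan_def atLeast_def Int_def Compl_eq not_le)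
  show ?thesis unfolding q_def[symmetric]
  proof (induction k arbitrary: j)
    case 0
    then show ?case using assms(2) by (cases j) (auto simp: sum_tail_0)
  next
    case (Suc k)
    have "ennreal (1 - pb_below (Suc k) q 0 j) =
        ennreal (1 - pb_below k q 0 (j - 1)) * ennreal q + ennreal (1 - pb_below k q 0 j) * ennreal (1 - q)"
      by (rule ennreal_binomial_tail_Suc[OF q])
    also have "\<dots> = (\<integral>\<^sup>+ t. ennreal (1 - pb_below k q 0 (j - 1)) * indicator {p..} t
          + ennreal (1 - pb_below k q 0 j) * indicator {0..<p} t \<partial>F)"
      by (subst nn_integral_add) (auto simp: nn_integral_cmult_indicator F(2) finite_measure.emeasure_eq_measure[OF fin] q_def[symmetric] q')
    also have "\<dots> \<le> (\<integral>\<^sup>+ t. ennreal (sum_tail F k (real j * p - t)) \<partial>F)"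
    proof (rule nn_integral_mono)
      fix t
      consider "t < 0" | "0 \<le> t" "t < p" | "p \<le> t" by linarith
      then show "ennreal (1 - pb_below k q 0 (j - 1)) * indicator {p..} t
          + ennreal (1 - pb_below k q 0 j) * indicator {0..<p} t \<le> ennreal (sum_tail F k (real j * p - t))"
      proof cases
        case 1
        then show ?thesis using assms(2) by simp
      next
        case 2
        then show ?thesis using order_trans[OF Suc[of j] sum_tail_antimono[OF F(1,2), of "real j * p - t" "real j * p"]]
          by (simp add: ennreal_leI)
      next
        case 3
        \<comment> \<open>For \<open>j = 0\<close> the truncated \<open>j - 1\<close> is 0, and the
          claim holds since \<open>t\<close> is nonnegative.\<close>
        have "real j * p - t \<le> real (j - 1) * p"
          using 3 assms(2) by (cases j) (auto simp: algebra_simps)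
        then show ?thesis using 3 assms(2) order_trans[OF Suc[of "j - 1"] sum_tail_antimono[OF F(1,2)]]
          by (simp add: ennreal_leI)
      qed
    qed
    also have "\<dots> = ennreal (sum_tail F (Suc k) (real j * p))"
      by (simp add: sum_tail_Suc F)
    finally show ?case using sum_tail_bounds(1)[OF F(1)] by (simp del: pb_below.simps)
  qed
qed

section \<open>Tightness: Bernoulli values\<close>

definition bernoulli_dist :: "real \<Rightarrow> real measure" where
  "bernoulli_dist q = distr (measure_pmf (bernoulli_pmf q)) borel of_bool"

lemma prob_space_bernoulli_dist: "prob_space (bernoulli_dist q)"
  unfolding bernoulli_dist_def by (intro prob_space.prob_space_distr prob_space_measure_pmf) simp

lemma sets_bernoulli_dist: "sets (bernoulli_dist q) = sets borel"
  by (simp add: bernoulli_dist_def)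

lemma nn_integral_bernoulli_dist:
  assumes "0 \<le> q" "q \<le> 1" "f \<in> borel_measurable borel"
  shows "(\<integral>\<^sup>+ t. f t \<partial>bernoulli_dist q) = f 1 * ennreal q + f 0 * ennreal (1 - q)"
  using assms by (simp add: bernoulli_dist_def nn_integral_distr)

lemma measure_bernoulli_dist:
  assumes "0 \<le> q" "q \<le> 1" "A \<in> sets borel"
  shows "measure (bernoulli_dist q) A = indicator A 1 * q + indicator A 0 * (1 - q)"
proof -
  have fin: "finite_measure (bernoulli_dist q)"
    using prob_space_bernoulli_dist by (rule prob_space.finite_measure)
  have "ennreal (measure (bernoulli_dist q) A) = (\<integral>\<^sup>+ t. indicator A t \<partial>bernoulli_dist q)"
    using assms by (simp add: finite_measure.emeasure_eq_measure[OF fin] sets_bernoulli_dist)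
  also have "\<dots> = ennreal (indicator A 1 * q + indicator A 0 * (1 - q))"
    using assms by (subst nn_integral_bernoulli_dist) (auto simp: indicator_def simp flip: ennreal_plus)
  finally show ?thesis using assms by (subst (asm) ennreal_inj) auto
qed

lemma nonneg_dist_bernoulli_dist: "0 \<le> q \<Longrightarrow> q \<le> 1 \<Longrightarrow> nonneg_dist (bernoulli_dist q)"
  by (simp add: nonneg_dist_def prob_space_bernoulli_dist sets_bernoulli_dist measure_bernoulli_dist)

text \<open>The sum is an integer, so the threshold may be rounded up. Negative thresholds truncate
  to 0, where \<open>pb_below\<close> vanishes.\<close>

lemma sum_tail_bernoulli_dist:
  assumes "0 \<le> q" "q \<le> 1"
  shows "sum_tail (bernoulli_dist q) k y = 1 - pb_below k q 0 (nat \<lceil>y\<rceil>)"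
proof (induction k arbitrary: y)
  case 0
  show ?case by (cases "nat \<lceil>y\<rceil>") (auto simp: sum_tail_0)
next
  case (Suc k)
  have nc: "nat \<lceil>y - 1\<rceil> = nat \<lceil>y\<rceil> - 1" by linarith
  have [measurable]: "(\<lambda>t. ennreal (sum_tail (bernoulli_dist q) k (y - t))) \<in> borel_measurable borel"
    unfolding Suc by measurable
  have "ennreal (sum_tail (bernoulli_dist q) (Suc k) y) =
      ennreal (1 - pb_below k q 0 (nat \<lceil>y\<rceil> - 1)) * ennreal q + ennreal (1 - pb_below k q 0 (nat \<lceil>y\<rceil>)) * ennreal (1 - q)"
    using assms by (simp add: sum_tail_Suc prob_space_bernoulli_dist sets_bernoulli_dist nn_integral_bernoulli_dist Suc nc[simplified])
  also have "\<dots> = ennreal (1 - pb_below (Suc k) q 0 (nat \<lceil>y\<rceil>))"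
    by (rule ennreal_binomial_tail_Suc[OF assms, symmetric])
  finally show ?case
    using sum_tail_bounds(1)[OF prob_space_bernoulli_dist] pb_below_bounds[OF assms order_refl, of "Suc k"]
    by (subst (asm) ennreal_inj) (auto simp del: pb_below.simps)
qed

lemma BRev_eq_sum_tail: "BRev F k = (SUP p\<in>{0..}. ennreal (p * sum_tail F k p))"
  by (simp add: BRev_def sum_tail_def)

text \<open>Each item price \<open>p\<close> is answered by a bundle price \<open>j * p\<close>,
  with \<open>j\<close> chosen from the sale probability at \<open>p\<close>. Comparing price by
  price also covers infinite revenue.\<close>

lemma rho_SRev_le_BRev:
  assumes "1 \<le> k" "nonneg_dist F"
  shows "ennreal rho * SRev F k \<le> BRev F k"
proof -
  have "ennreal rho * SRev F k = (SUP p\<in>{0..}. ennreal rho * of_nat k * ennreal (p * measure F {p..}))"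
    unfolding SRev_def Rev_def by (simp add: SUP_mult_left_ennreal mult.assoc)
  also have "\<dots> \<le> BRev F k"
  proof (rule SUP_least)
    fix p :: real assume "p \<in> {0..}"
    then have p: "0 \<le> p" by simp
    let ?q = "measure F {p..}"
    obtain j where j: "rho * (real k * ?q) \<le> real j * (1 - pb_below k ?q 0 j)"
      using binomial_tail_revenue[of ?q k] assms by (auto simp: nonneg_dist_def prob_space.prob_le_1)
    have "rho * real k * (p * ?q) = (rho * (real k * ?q)) * p" by simp
    also have "\<dots> \<le> (real j * (1 - pb_below k ?q 0 j)) * p"
      using j p by (intro mult_right_mono)
    also have "\<dots> \<le> (real j * sum_tail F k (real j * p)) * p"
      using p sum_tail_ge_binomial[OF assms(2) p] by (intro mult_right_mono mult_left_mono) auto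
    finally have "ennreal (rho * real k * (p * ?q)) \<le> ennreal ((real j * p) * sum_tail F k (real j * p))"
      by (intro ennreal_leI) (simp add: mult_ac)
    also have "\<dots> \<le> BRev F k"
      unfolding BRev_eq_sum_tail using p by (intro SUP_upper2[of "real j * p"]) auto
    also have "ennreal (rho * real k * (p * ?q)) = ennreal rho * of_nat k * ennreal (p * ?q)"
      using rho_bounds p by (simp add: ennreal_mult ennreal_of_nat_eq_real_of_nat)
    finally show "ennreal rho * of_nat k * ennreal (p * ?q) \<le> BRev F k" .
  qed
  finally show ?thesis .
qed

text \<open>Up to \<open>j = 6\<close> the Le Cam error is multiplied by at most 6. From
  \<open>j = 7\<close> on, the union bound alone stays below \<open>rho * cstar\<close>.\<close>

lemma binomial_tail_revenue_le:
  assumes "cstar \<le> real (Suc n)"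
  shows "real j * (1 - pb_below (Suc n) (cstar / real (Suc n)) 0 j) \<le> rho * cstar + 6 * cstar\<^sup>2 / real (Suc n)"
proof -
  let ?q = "cstar / real (Suc n)"
  have q: "0 \<le> ?q" "?q \<le> 1" "real (Suc n) * ?q = cstar"
    using assms cstar(1) by (auto simp del: of_nat_Suc)
  have err: "0 \<le> cstar\<^sup>2 / real (Suc n)" by simp
  consider "j = 0" | "1 \<le> j" "j \<le> 6" | "7 \<le> j" by linarith
  then show ?thesis
  proof cases
    case 1
    then show ?thesis using rho_bounds cstar(1) err by (simp del: of_nat_Suc)
  next
    case 2
    then obtain m where m: "j = Suc m" by (cases j) auto
    have "real (Suc n) * ?q\<^sup>2 = cstar\<^sup>2 / real (Suc n)"
      by (simp add: power2_eq_square del: of_nat_Suc)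
    then have tail: "1 - pb_below (Suc n) ?q 0 j \<le> h j cstar + cstar\<^sup>2 / real (Suc n)"
      and bound: "real j * h j cstar \<le> rho * cstar"
      using le_Cam_binomial[OF q(1,2), of n m] h_cstar_le_rho[OF 2(2)] unfolding m q(3)
      by (simp_all del: of_nat_Suc pb_below.simps)
    from tail have "real j * (1 - pb_below (Suc n) ?q 0 j) \<le> real j * (h j cstar + cstar\<^sup>2 / real (Suc n))"
      by (intro mult_left_mono) auto
    also have "\<dots> = real j * h j cstar + real j * (cstar\<^sup>2 / real (Suc n))"
      by (simp add: distrib_left)
    also have "\<dots> \<le> rho * cstar + 6 * (cstar\<^sup>2 / real (Suc n))"
      using 2 err bound by (intro add_mono mult_right_mono) (auto simp del: of_nat_Suc)
    finally show ?thesis by simp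
  next
    case 3
    have c: "0 \<le> cstar" "cstar \<le> 2.7" using cstar_bounds cstar(1) by auto
    \<comment> \<open>Consecutive terms have ratio \<open>cstar / Suc m\<close>, below 1, so
      \<open>j = 7\<close> is the worst case, and \<open>2.7 ^ 7 / 720\<close> is below
      1.46.\<close>
    have dec: "cstar ^ Suc m / fact m \<le> 1.46" if "6 \<le> m" for m
      using that
    proof (induction m rule: dec_induct)
      case base
      have "cstar ^ 7 \<le> 2.7 ^ 7" using c by (intro power_mono)
      then show ?case by (simp add: fact_numeral eval_nat_numeral)
    next
      case (step m)
      have "cstar ^ Suc (Suc m) / fact (Suc m) = (cstar ^ Suc m / fact m) * (cstar / real (Suc m))"
        by (simp add: field_simps)
      also have "\<dots> \<le> 1.46 * 1"
        using step c by (intro mult_mono) auto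
      finally show ?case by simp
    qed
    obtain m where m: "j = Suc m" "6 \<le> m" using 3 by (cases j) auto
    have "real j * (1 - pb_below (Suc n) ?q 0 j) \<le> real j * (cstar ^ j / fact j)"
      using binomial_tail_le[OF q(1,2), of "Suc n" j] unfolding q(3)
      by (intro mult_left_mono) auto
    also have "\<dots> = cstar ^ Suc m / fact m"
      by (simp add: m(1) del: of_nat_Suc)
    also have "\<dots> \<le> 1.46" using dec m by simp
    also have "\<dots> \<le> rho * cstar"
    proof -
      have "1.46 * (1 + cstar + 3 / 2 * cstar\<^sup>2) \<le> 3 * cstar\<^sup>2"
        using mult_mono[OF cstar_bounds(1) cstar_bounds(1)] cstar_bounds
        by (simp add: power2_eq_square field_simps)
      then show ?thesis
        unfolding rho_cstar_eq using c by (subst pos_le_divide_eq) (auto intro!: add_pos_nonneg)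
    qed
    finally show ?thesis using err by (simp add: add_increasing2 del: of_nat_Suc pb_below.simps)
  qed
qed

text \<open>Rounding the price up to an integer loses no sale, so only integer bundle prices
  matter.\<close>

lemma BRev_bernoulli_le:
  assumes "cstar \<le> real (Suc n)"
  shows "BRev (bernoulli_dist (cstar / real (Suc n))) (Suc n) \<le> ennreal (rho * cstar + 6 * cstar\<^sup>2 / real (Suc n))"
  unfolding BRev_eq_sum_tail
proof (rule SUP_least)
  fix p :: real assume "p \<in> {0..}"
  let ?q = "cstar / real (Suc n)"
  have q: "0 \<le> ?q" "?q \<le> 1"
    using assms cstar(1) by (auto simp del: of_nat_Suc)
  have "p * sum_tail (bernoulli_dist ?q) (Suc n) p \<le> real (nat \<lceil>p\<rceil>) * (1 - pb_below (Suc n) ?q 0 (nat \<lceil>p\<rceil>))"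
    unfolding sum_tail_bernoulli_dist[OF q] using pb_below_bounds[OF q order_refl, of "Suc n"]
    by (intro mult_right_mono) (auto simp del: pb_below.simps simp: real_nat_ceiling_ge)
  also have "\<dots> \<le> rho * cstar + 6 * cstar\<^sup>2 / real (Suc n)"
    by (rule binomial_tail_revenue_le[OF assms])
  finally show "ennreal (p * sum_tail (bernoulli_dist ?q) (Suc n) p) \<le> ennreal (rho * cstar + 6 * cstar\<^sup>2 / real (Suc n))"
    by (rule ennreal_leI)
qed

lemma SRev_bernoulli_ge:
  assumes "0 \<le> q" "q \<le> 1"
  shows "ennreal (real k * q) \<le> SRev (bernoulli_dist q) k"
proof -
  have "ennreal q \<le> Rev (bernoulli_dist q)"
    unfolding Rev_def using assms by (intro SUP_upper2[of 1]) (auto simp: measure_bernoulli_dist)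
  then have "of_nat k * ennreal q \<le> SRev (bernoulli_dist q) k"
    unfolding SRev_def by (intro mult_left_mono) auto
  then show ?thesis using assms by (simp add: ennreal_mult ennreal_of_nat_eq_real_of_nat)
qed

lemma BRev_bernoulli_lt:
  assumes "0 < \<epsilon>"
  shows "\<exists>k F. 1 \<le> k \<and> nonneg_dist F \<and> BRev F k < ennreal (rho + \<epsilon>) * SRev F k"
proof -
  \<comment> \<open>The first bound makes \<open>cstar / Suc n\<close> a probability. The second
    pushes the error \<open>6 * cstar\<^sup>2 / Suc n\<close> below
    \<open>\<epsilon> * cstar\<close>.\<close>
  obtain n where n: "max cstar (6 * cstar / \<epsilon>) < real n" using reals_Archimedean2 by blast
  let ?k = "real (Suc n)" and ?F = "bernoulli_dist (cstar / real (Suc n))"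
  have k: "cstar \<le> ?k" "6 * cstar < ?k * \<epsilon>"
    using n assms by (auto simp: divide_less_eq algebra_simps)
  have q: "0 \<le> cstar / ?k" "cstar / ?k \<le> 1"
    using k cstar(1) by (auto simp del: of_nat_Suc)
  have "6 * cstar * cstar < ?k * \<epsilon> * cstar"
    using k(2) cstar(1) by (intro mult_strict_right_mono)
  then have "6 * cstar\<^sup>2 / ?k < \<epsilon> * cstar"
    by (simp add: divide_less_eq power2_eq_square mult_ac del: of_nat_Suc)
  have "BRev ?F (Suc n) \<le> ennreal (rho * cstar + 6 * cstar\<^sup>2 / ?k)"
    by (rule BRev_bernoulli_le[OF k(1)])
  also have "\<dots> < ennreal ((rho + \<epsilon>) * cstar)"
    using \<open>6 * cstar\<^sup>2 / ?k < \<epsilon> * cstar\<close> rho_bounds(1) cstar(1) assms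
    by (intro ennreal_lessI mult_pos_pos) (simp_all add: distrib_right del: of_nat_Suc)
  also have "\<dots> = ennreal (rho + \<epsilon>) * ennreal (?k * (cstar / ?k))"
    using rho_bounds cstar(1) assms by (simp add: ennreal_mult del: of_nat_Suc)
  also have "\<dots> \<le> ennreal (rho + \<epsilon>) * SRev ?F (Suc n)"
    by (intro mult_left_mono SRev_bernoulli_ge[OF q]) auto
  finally show ?thesis using nonneg_dist_bernoulli_dist[OF q] by (intro exI[of _ "Suc n"] exI[of _ ?F]) auto
qed

theorem theorem1:
  shows "(\<exists>!c. c > 0 \<and> 2 * h 2 c = 3 * h 3 c)
    \<and> (\<forall>(k::nat) F. k \<ge> 1 \<longrightarrow> nonneg_dist F \<longrightarrow>
          BRev F k \<ge> ennreal rho * SRev F k \<and> SRev F k = of_nat k * Rev F)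
    \<and> (\<forall>\<epsilon>::real. \<epsilon> > 0 \<longrightarrow> (\<exists>(k::nat) F. k \<ge> 1 \<and> nonneg_dist F \<and>
          BRev F k < ennreal (rho + \<epsilon>) * SRev F k))"
  using crossing_ex1 rho_SRev_le_BRev BRev_bernoulli_lt by (auto simp: SRev_def)

end
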